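(* Let $n\ge2$ and $m,l\ge2$ be integers, and let $(\bar\Lambda,\bar{\boldsymbol a},\bar\Theta,\bar{\boldsymbol b},\bar K)\in\mathcal F_{m,n}\times\mathbb R^n\times\mathcal F_{l,n}\times\mathbb R^n\times\mathscr C(\mathbb R^n)$. If the leading tensor pair $(\bar{\mathcal A}^{(1)},\bar{\mathcal B}^{(1)})$ in $(\bar\Lambda,\bar\Theta)$ is an $\mathbf R_0^{\bar K}$-tensor pair, then $\mathrm{SOL}(\bar\Lambda,\bar{\boldsymbol a},\bar\Theta,\bar{\boldsymbol b},\bar K)$ is compact.
   Context: $\mathbb T_{m,n}$ is the space of real $m$-th order $n$-dimensional square tensors $\mathcal A=(a_{j_1\ldots j_m})$, $1\le j_1,\ldots,j_m\le n$. $\mathcal F_{m,n}:=\mathbb T_{m,n}\times\mathbb T_{m-1,n}\times\cdots\times\mathbb T_{2,n}$, with elements written $\Lambda=(\mathcal A^{(1)},\ldots,\mathcal A^{(m-1)})$, $\mathcal A^{(k)}\in\mathbb T_{m-k+1,n}$; elements of $\mathcal F_{l,n}$ are written $\Theta=(\mathcal B^{(1)},\ldots,\mathcal B^{(l-1)})$. The leading tensor pair of $(\Lambda,\Theta)$ is $(\mathcal A^{(1)},\mathcal B^{(1)})$. For $\mathcal A\in\mathbb T_{m,n}$ and $\boldsymbol x\in\mathbb R^n$, $\mathcal A\boldsymbol x^{m-1}\in\mathbb R^n$ has $j$-th component $\sum_{j_2,\ldots,j_m=1}^n a_{jj_2\ldots j_m}x_{j_2}\cdots x_{j_m}$. $\mathscr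 C(\mathbb R^n)$ is the set of nonzero closed convex cones in $\mathbb R^n$. The dual cone of $K$ is $K^*:=\{\boldsymbol y\in\mathbb R^n\mid\langle\boldsymbol y,\boldsymbol x\rangle\ge0\ \forall\boldsymbol x\in K\}$. $\mathrm{SOL}(\Lambda,\boldsymbol a,\Theta,\boldsymbol b,K)$ is the set of all $\boldsymbol x\in\mathbb R^n$ with $F(\boldsymbol x)\in K$, $G(\boldsymbol x)\in K^*$, $\langle F(\boldsymbol x),G(\boldsymbol x)\rangle=0$, where $F(\boldsymbol x):=\sum_{k=1}^{m-1}\mathcal A^{(k)}\boldsymbol x^{m-k}+\boldsymbol a$ and $G(\boldsymbol x):=\sum_{p=1}^{l-1}\mathcal B^{(p)}\boldsymbol x^{l-p}+\boldsymbol b$. A pair $(\mathcal A,\mathcal B)\in\mathbb T_{m,n}\times\mathbb T_{l,n}$ is an $\mathbf R_0^K$-tensor pair if there exists no $\boldsymbol x\in\mathbb R^n\setminus\{\boldsymbol 0\}$ such that $\mathcal A\boldsymbol x^{m-1}\in K$, $\mathcal B\boldsymbol x^{l-1}\in K^*$ and $\langle\mathcal A\boldsymbol x^{m-1},\mathcal B\boldsymbol x^{l-1}\rangle=0$. *)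

theory Defs
  imports "HOL-Analysis.Analysis"
begin

text \<open>
  An order-\<open>m\<close> tensor of dimension \<open>n = CARD('n)\<close> is a function on index lists; it is
  supported on lists of length \<open>m\<close>, where its value at \<open>[j\<^sub>1, \<dots>, j\<^sub>m]\<close> is the entry
  \<open>a\<close> with indices \<open>j\<^sub>1 \<dots> j\<^sub>m\<close>. The zero value off those lists makes the representation unique.
\<close>

type_synonym 'n tensor = "'n list \<Rightarrow> real"

definition tensors :: "nat \<Rightarrow> ('n::finite) tensor set" where
  "tensors m = {A. \<forall>js. length js \<noteq> m \<longrightarrow> A js = 0}"

text \<open>
  A tuple of tensors of orders \<open>m, m - 1, \<dots>, 2\<close>, indexed by \<open>1, \<dots>, m - 1\<close>.
\<close>

definition tensor_tuples :: "nat \<Rightarrow> (nat \<Rightarrow> ('n::finite) tensor) set" where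
  "tensor_tuples m = (\<Pi>\<^sub>E k\<in>{1..m - 1}. tensors (m - k + 1))"

text \<open>
  \<open>tensor_pow A x r\<close> is the vector \<open>A x\<^sup>r\<close> for a tensor \<open>A\<close> of order \<open>r + 1\<close>.
\<close>

definition tensor_pow :: "('n::finite) tensor \<Rightarrow> real ^ 'n \<Rightarrow> nat \<Rightarrow> real ^ 'n" where
  "tensor_pow A x r =
     (\<chi> j. \<Sum>js\<in>{js. length js = r}. A (j # js) * (\<Prod>i\<leftarrow>js. x $ i))"

definition tensor_poly :: "nat \<Rightarrow> (nat \<Rightarrow> ('n::finite) tensor) \<Rightarrow> real ^ 'n \<Rightarrow> real ^ 'n \<Rightarrow> real ^ 'n" where
  "tensor_poly m \<Lambda> a x = (\<Sum>k = 1..m - 1. tensor_pow (\<Lambda> k) x (m - k)) + a"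

text \<open>
  The library's \<^const>\<open>cone\<close> is closed under scaling by all \<open>c \<ge> 0\<close> and admits the empty set,
  so nonemptiness is required separately; every member contains \<open>0\<close>.
\<close>

definition closed_convex_cones :: "(real ^ 'n::finite) set set" where
  "closed_convex_cones = {K. cone K \<and> convex K \<and> closed K \<and> K \<noteq> {} \<and> K \<noteq> {0}}"

definition dual_cone :: "(real ^ 'n::finite) set \<Rightarrow> (real ^ 'n) set" where
  "dual_cone K = {y. \<forall>x\<in>K. y \<bullet> x \<ge> 0}"

definition SOL ::
  "nat \<Rightarrow> nat \<Rightarrow> (nat \<Rightarrow> ('n::finite) tensor) \<Rightarrow> real ^ 'n \<Rightarrow> (nat \<Rightarrow> 'n tensor) \<Rightarrow> real ^ 'n
    \<Rightarrow> (real ^ 'n) set \<Rightarrow> (real ^ 'n) set" where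
  "SOL m l \<Lambda> a \<Theta> b K =
     {x. tensor_poly m \<Lambda> a x \<in> K \<and> tensor_poly l \<Theta> b x \<in> dual_cone K \<and>
         tensor_poly m \<Lambda> a x \<bullet> tensor_poly l \<Theta> b x = 0}"

definition R0_tensor_pair ::
  "nat \<Rightarrow> nat \<Rightarrow> (real ^ 'n::finite) set \<Rightarrow> 'n tensor \<Rightarrow> 'n tensor \<Rightarrow> bool" where
  "R0_tensor_pair m l K A B \<longleftrightarrow>
     A \<in> tensors m \<and> B \<in> tensors l \<and>
     \<not> (\<exists>x. x \<noteq> 0 \<and> tensor_pow A x (m - 1) \<in> K \<and> tensor_pow B x (l - 1) \<in> dual_cone K \<and>
            tensor_pow A x (m - 1) \<bullet> tensor_pow B x (l - 1) = 0)"

end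

theory Submission imports Defs
begin

text \<open>
  Homogenize both polynomial maps with an extra variable \<open>t\<close>, so that the homogenization at
  \<open>(y, t)\<close> is a positive multiple of the original map at \<open>y / t\<close> for \<open>t > 0\<close> and equals the
  leading term at \<open>t = 0\<close>. Since the conditions are invariant under positive scaling, a solution
  \<open>x\<close> of norm at least \<open>1\<close> yields the point \<open>(x / |x|, 1 / |x|)\<close> of the compact set of
  homogenized solutions with \<open>|y| = 1\<close> and \<open>0 \<le> t \<le> 1\<close>. The \<open>R\<^sub>0\<close> condition says that \<open>t\<close> does
  not vanish on this set, so \<open>t\<close> is bounded below there and \<open>|x| = 1 / t\<close> is bounded above.
\<close>

definition homog_tensor_poly ::
  "nat \<Rightarrow> (nat \<Rightarrow> ('n::finite) tensor) \<Rightarrow> real ^ 'n \<Rightarrow> real ^ 'n \<Rightarrow> real \<Rightarrow> real ^ 'n" where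
  "homog_tensor_poly m \<Lambda> a y t =
     (\<Sum>k = 1..m - 1. t ^ (k - 1) *\<^sub>R tensor_pow (\<Lambda> k) y (m - k)) + t ^ (m - 1) *\<^sub>R a"

lemma prod_list_map_mult_const:
  fixes c :: "'a::comm_monoid_mult"
  shows "(\<Prod>i\<leftarrow>is. c * f i) = c ^ length is * (\<Prod>i\<leftarrow>is. f i)"
  by (induction "is") (simp_all add: ac_simps)

lemma continuous_on_prod_list:
  fixes f :: "'i \<Rightarrow> 'a::topological_space \<Rightarrow> 'b::{real_normed_algebra_1,comm_monoid_mult}"
  assumes "\<And>i. i \<in> set is \<Longrightarrow> continuous_on S (f i)"
  shows "continuous_on S (\<lambda>x. \<Prod>i\<leftarrow>is. f i x)"
  using assms by (induction "is") (auto intro!: continuous_intros)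

lemma tensor_pow_scaleR: "tensor_pow A (c *\<^sub>R x) r = c ^ r *\<^sub>R tensor_pow A x r"
  by (simp add: tensor_pow_def vec_eq_iff prod_list_map_mult_const sum_distrib_left mult.left_commute)

lemma continuous_on_tensor_pow [continuous_intros]:
  assumes "continuous_on S f"
  shows "continuous_on S (\<lambda>z. tensor_pow A (f z) r)"
  unfolding tensor_pow_def
  by (intro continuous_on_vec_lambda continuous_on_sum continuous_on_mult continuous_on_const
      continuous_on_prod_list continuous_on_component assms)

lemma continuous_on_tensor_poly [continuous_intros]:
  "continuous_on S f \<Longrightarrow> continuous_on S (\<lambda>z. tensor_poly m \<Lambda> a (f z))"
  unfolding tensor_poly_def by (intro continuous_intros)

lemma continuous_on_homog_tensor_poly [continuous_intros]:
  assumes "continuous_on S f" and "continuous_on S g"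
  shows "continuous_on S (\<lambda>z. homog_tensor_poly m \<Lambda> a (f z) (g z))"
  unfolding homog_tensor_poly_def by (intro continuous_intros assms)

text \<open>Since \<open>0 ^ 0 = 1\<close>, only the summand \<open>k = 1\<close> survives;
  \<open>m \<ge> 2\<close> makes that index occur and kills the constant term.\<close>

lemma homog_tensor_poly_0:
  assumes "m \<ge> 2"
  shows "homog_tensor_poly m \<Lambda> a y 0 = tensor_pow (\<Lambda> 1) y (m - 1)"
proof -
  have "(\<Sum>k = 1..m - 1. (0::real) ^ (k - 1) *\<^sub>R tensor_pow (\<Lambda> k) y (m - k))
      = (\<Sum>k\<in>{1}. (0::real) ^ (k - 1) *\<^sub>R tensor_pow (\<Lambda> k) y (m - k))"
    using assms by (intro sum.mono_neutral_right) (auto simp: power_0_left)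
  then show ?thesis
    using assms by (simp add: homog_tensor_poly_def power_0_left)
qed

text \<open>Each summand has total degree \<open>(k - 1) + (m - k) = m - 1\<close> in
  \<open>(y, t)\<close>; the range of \<open>k\<close> keeps the natural subtractions exact.\<close>

lemma homog_tensor_poly_scaleR:
  "homog_tensor_poly m \<Lambda> a (t *\<^sub>R x) t = t ^ (m - 1) *\<^sub>R tensor_poly m \<Lambda> a x"
proof -
  have "t ^ (k - 1) *\<^sub>R tensor_pow (\<Lambda> k) (t *\<^sub>R x) (m - k)
      = t ^ (m - 1) *\<^sub>R tensor_pow (\<Lambda> k) x (m - k)" if "k \<in> {1..m - 1}" for k
  proof -
    have "k - 1 + (m - k) = m - 1"
      using that by auto
    then show ?thesis
      by (simp add: tensor_pow_scaleR flip: power_add)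
  qed
  then show ?thesis
    by (simp add: homog_tensor_poly_def tensor_poly_def scaleR_add_right scaleR_sum_right)
qed

lemma closed_dual_cone: "closed (dual_cone K)"
proof -
  have "dual_cone K = (\<Inter>x\<in>K. {y. y \<bullet> x \<ge> 0})"
    by (auto simp: dual_cone_def)
  then show ?thesis
    by (auto intro!: closed_INT closed_Collect_le continuous_intros)
qed

lemma dual_cone_scaleR: "y \<in> dual_cone K \<Longrightarrow> c \<ge> 0 \<Longrightarrow> c *\<^sub>R y \<in> dual_cone K"
  by (simp add: dual_cone_def)

text \<open>The general domain serves both the solution set itself and the homogenized set, which
  lives in a product space.\<close>

lemma closed_complementarity:
  fixes F G :: "'a::t2_space \<Rightarrow> real ^ 'n::finite"
  assumes "closed K" and "continuous_on UNIV F" and "continuous_on UNIV G"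
  shows "closed {z. F z \<in> K \<and> G z \<in> dual_cone K \<and> F z \<bullet> G z = 0}"
proof -
  have "closed (F -` K)" "closed (G -` dual_cone K)"
    using assms closed_dual_cone by (auto intro: closed_vimage)
  moreover have "closed {z. F z \<bullet> G z = 0}"
    using assms by (intro closed_Collect_eq continuous_intros)
  moreover have "{z. F z \<in> K \<and> G z \<in> dual_cone K \<and> F z \<bullet> G z = 0}
      = F -` K \<inter> G -` dual_cone K \<inter> {z. F z \<bullet> G z = 0}"
    by auto
  ultimately show ?thesis
    by (simp add: closed_Int)
qed

lemma closed_SOL: "closed K \<Longrightarrow> closed (SOL m l \<Lambda> a \<Theta> b K)"
  unfolding SOL_def by (intro closed_complementarity continuous_intros)

lemma bounded_SOL:
  fixes \<Lambda> \<Theta> :: "nat \<Rightarrow> ('n::finite) tensor"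
  assumes "m \<ge> 2" and "l \<ge> 2" and "closed K" and "cone K"
    and R0: "R0_tensor_pair m l K (\<Lambda> 1) (\<Theta> 1)"
  shows "bounded (SOL m l \<Lambda> a \<Theta> b K)"
proof -
  define H where "H = (\<lambda>z. homog_tensor_poly m \<Lambda> a (fst z) (snd z))"
  define I where "I = (\<lambda>z. homog_tensor_poly l \<Theta> b (fst z) (snd z))"
  define C where "C = (sphere 0 1 \<times> {0..1}) \<inter> {z. H z \<in> K \<and> I z \<in> dual_cone K \<and> H z \<bullet> I z = 0}"
  have "compact C"
    unfolding C_def H_def I_def
    by (intro compact_Int_closed compact_Times compact_sphere compact_Icc closed_complementarity
        continuous_intros assms)
  \<comment> \<open>Otherwise \<open>t = 0\<close>, and the unit vector \<open>fst z\<close>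
    violates the \<open>R0\<close> condition.\<close>
  have pos: "snd z > 0" if "z \<in> C" for z
  proof (rule ccontr)
    assume "\<not> snd z > 0"
    with that have z: "z = (fst z, 0)"
      by (auto simp: C_def prod_eq_iff)
    moreover have "fst z \<noteq> 0"
      using that by (auto simp: C_def)
    moreover have "H z = tensor_pow (\<Lambda> 1) (fst z) (m - 1)" "I z = tensor_pow (\<Theta> 1) (fst z) (l - 1)"
      \<comment> \<open>Only \<open>snd z = 0\<close> is extracted, as rewriting with
        \<open>z\<close> itself would loop.\<close>
      using assms(1,2) arg_cong [OF z, of snd] by (simp_all add: H_def I_def homog_tensor_poly_0)
    ultimately show False
      using R0 that by (auto simp: C_def R0_tensor_pair_def)
  qed
  have inC: "(inverse (norm x) *\<^sub>R x, inverse (norm x)) \<in> C"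
    if "x \<in> SOL m l \<Lambda> a \<Theta> b K" and "norm x \<ge> 1" for x
  proof -
    have "x \<noteq> 0"
      using that(2) by auto
    then show ?thesis
      \<comment> \<open>\<open>H\<close> and \<open>I\<close> here are nonnegative multiples of the
        values at \<open>x\<close>, so all three conditions persist; \<open>norm x \<ge> 1\<close>
        gives \<open>t \<le> 1\<close>.\<close>
      using that assms(4) unfolding C_def H_def I_def
      by (auto simp: SOL_def homog_tensor_poly_scaleR inverse_le_1_iff
          intro: mem_cone dual_cone_scaleR)
  qed
  obtain e where "e > 0" and e: "\<And>z. z \<in> C \<Longrightarrow> e \<le> snd z"
  proof (cases "C = {}")
    case True
    then show ?thesis
      \<comment> \<open>On the empty set any positive bound works.\<close>
      using that [of 1] by auto
  next
    case False
    then obtain w where "w \<in> C" "\<forall>z\<in>C. snd w \<le> snd z"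
      using continuous_attains_inf [OF \<open>compact C\<close> False continuous_on_snd [OF continuous_on_id]]
      by blast
    then show ?thesis
      using that pos by blast
  qed
  \<comment> \<open>The \<open>1\<close> covers solutions inside the unit ball, to which
    \<open>inC\<close> does not apply.\<close>
  have "norm x \<le> max 1 (inverse e)" if "x \<in> SOL m l \<Lambda> a \<Theta> b K" for x
  proof (cases "norm x \<ge> 1")
    case True
    then have "e \<le> inverse (norm x)"
      using e [OF inC [OF that]] by simp
    then show ?thesis
      using le_imp_inverse_le [of e "inverse (norm x)"] \<open>e > 0\<close> by simp
  qed simp
  then show ?thesis
    by (auto simp: bounded_iff)
qed

theorem corollary4p4:
  fixes m l :: nat
    and \<Lambda> \<Theta> :: "nat \<Rightarrow> ('n::finite) tensor"
    and a b :: "real ^ 'n"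
    and K :: "(real ^ 'n) set"
  assumes "CARD('n) \<ge> 2" and "m \<ge> 2" and "l \<ge> 2"
    and "\<Lambda> \<in> tensor_tuples m" and "\<Theta> \<in> tensor_tuples l"
    and "K \<in> closed_convex_cones"
    and "R0_tensor_pair m l K (\<Lambda> 1) (\<Theta> 1)"
  shows "compact (SOL m l \<Lambda> a \<Theta> b K)"
  using assms
  by (auto simp: compact_eq_bounded_closed closed_convex_cones_def
      intro: closed_SOL bounded_SOL)

end
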